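(* The connected components of $\mathcal{R}$ are the sets $\mathcal{R}_{P_0}$, $P_0\in\mathcal{P}(\mathcal{H})$, where two projections $P_0$ and $P_1$ define the same component if and only if they are unitarily equivalent.
   Context: $\mathcal{H}$ is a complex Hilbert space, $\mathcal{B}(\mathcal{H})$ the bounded operators with the operator norm, $\mathcal{U}(\mathcal{H})$ the unitary group, $\mathcal{P}(\mathcal{H})$ the set of orthogonal projections on $\mathcal{H}$. $\mathcal{R}=\{(P,f)\in\mathcal{P}(\mathcal{H})\times\mathcal{H}: Pf=f,\ \|f\|=1\}$ carries the topology inherited from $\mathcal{B}(\mathcal{H})\times\mathcal{H}$, and $\mathcal{R}_{P_0}=\{(P,f)\in\mathcal{R}: P=WP_0W^* \text{ for some } W\in\mathcal{U}(\mathcal{H})\}$. Projections $P_0,P_1$ are unitarily equivalent if $P_1=WP_0W^*$ for some $W\in\mathcal{U}(\mathcal{H})$. *)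

theory Defs
  imports "HOL-Analysis.Analysis"
begin

section \<open>Complex Hilbert spaces\<close>

class complex_vector = real_vector +
  fixes scaleC :: "complex \<Rightarrow> 'a \<Rightarrow> 'a" (infixr "*\<^sub>C" 75)
  assumes scaleC_add_right: "c *\<^sub>C (x + y) = c *\<^sub>C x + c *\<^sub>C y"
    and scaleC_add_left: "(c + d) *\<^sub>C x = c *\<^sub>C x + d *\<^sub>C x"
    and scaleC_scaleC: "c *\<^sub>C d *\<^sub>C x = (c * d) *\<^sub>C x"
    and scaleC_one: "1 *\<^sub>C x = x"
    and scaleR_scaleC: "r *\<^sub>R x = complex_of_real r *\<^sub>C x"

text \<open>The inner product is linear in the first argument. The last axiom says that the norm is the
  one induced by the inner product; together with the norm axioms it makes the inner product
  positive definite.\<close>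

class complex_inner = complex_vector + real_normed_vector +
  fixes cinner :: "'a \<Rightarrow> 'a \<Rightarrow> complex"
  assumes cinner_commute: "cinner x y = cnj (cinner y x)"
    and cinner_add_left: "cinner (x + y) z = cinner x z + cinner y z"
    and cinner_scaleC_left: "cinner (c *\<^sub>C x) y = c * cinner x y"
    and cinner_self: "cinner x x = complex_of_real ((norm x)\<^sup>2)"

class chilbert_space = complex_inner + complete_space

instantiation complex :: chilbert_space
begin

definition scaleC_complex :: "complex \<Rightarrow> complex \<Rightarrow> complex" where
  "scaleC_complex c x = c * x"

definition cinner_complex :: "complex \<Rightarrow> complex \<Rightarrow> complex" where
  "cinner_complex x y = x * cnj y"

instance
  by standard
    (simp_all add: scaleC_complex_def cinner_complex_def algebra_simps scaleR_conv_of_real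
      complex_norm_square[symmetric])

end


section \<open>Bounded operators\<close>

text \<open>The type of bounded operators in the library consists of real-linear maps. The algebra
  of bounded complex-linear operators is the following subset of it, and the operator norm
  is the norm of that type.\<close>

definition bounded_ops :: "('a::chilbert_space \<Rightarrow>\<^sub>L 'a) set" where
  "bounded_ops = {A. \<forall>c x. blinfun_apply A (c *\<^sub>C x) = c *\<^sub>C blinfun_apply A x}"

definition cadjoint :: "('a::chilbert_space \<Rightarrow>\<^sub>L 'a) \<Rightarrow> ('a \<Rightarrow>\<^sub>L 'a)" where
  "cadjoint A = (THE B. B \<in> bounded_ops \<and>
     (\<forall>x y. cinner (blinfun_apply A x) y = cinner x (blinfun_apply B y)))"

definition unitary_ops :: "('a::chilbert_space \<Rightarrow>\<^sub>L 'a) set" where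
  "unitary_ops = {W \<in> bounded_ops.
     cadjoint W o\<^sub>L W = id_blinfun \<and> W o\<^sub>L cadjoint W = id_blinfun}"

definition projections :: "('a::chilbert_space \<Rightarrow>\<^sub>L 'a) set" where
  "projections = {P \<in> bounded_ops. P o\<^sub>L P = P \<and> cadjoint P = P}"

definition unitarily_equivalent ::
    "('a::chilbert_space \<Rightarrow>\<^sub>L 'a) \<Rightarrow> ('a \<Rightarrow>\<^sub>L 'a) \<Rightarrow> bool" where
  "unitarily_equivalent P0 P1 \<longleftrightarrow> (\<exists>W\<in>unitary_ops. P1 = W o\<^sub>L P0 o\<^sub>L cadjoint W)"


section \<open>Projections with a unit vector in their range\<close>

definition proj_vectors :: "(('a::chilbert_space \<Rightarrow>\<^sub>L 'a) \<times> 'a) set" where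
  "proj_vectors = {(P, f). P \<in> projections \<and> blinfun_apply P f = f \<and> norm f = 1}"

definition proj_vectors_orbit ::
    "('a::chilbert_space \<Rightarrow>\<^sub>L 'a) \<Rightarrow> (('a \<Rightarrow>\<^sub>L 'a) \<times> 'a) set" where
  "proj_vectors_orbit P0 = {(P, f) \<in> proj_vectors. \<exists>W\<in>unitary_ops. P = W o\<^sub>L P0 o\<^sub>L cadjoint W}"

text \<open>The zero projection has no unit vector in its range, so its orbit set is empty and is not
  a connected component.\<close>

lemma proj_vectors_orbit_zero: "proj_vectors_orbit 0 = {}"
proof -
  have "W o\<^sub>L 0 o\<^sub>L V = 0" for W V :: "'a \<Rightarrow>\<^sub>L 'a"
    by (rule blinfun_eqI) (simp add: blinfun.zero_right)
  then show ?thesis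
    by (auto simp: proj_vectors_orbit_def proj_vectors_def)
qed

end

theory Submission
  imports Defs
begin

text \<open>
  The sets in question are the classes of pairs with unitarily equivalent projections. They
  partition the space of pairs, and two facts make them its connected components: each class is open
  in the space, and each class is path-connected.

  Openness holds because projections P and Q with norm (P - Q) < 1 are unitarily equivalent
  (lemma unitarily_equivalent_if_norm_diff_less). The operator H = P + Q - 1 intertwines them,
  and its polar decomposition yields a symmetry S with S P S = Q.

  Path-connectedness comes down to the unitary group (lemma path_connected_unitary_ops): the pair
  (P0, g) can be moved along a path of unitaries from 1 to W until it becomes (W P0 W*, W g), and unit
  vectors in the range of one projection can be joined within this range.

  Connectedness of the unitary group is usually read off from U = exp (i A), which requires the
  Borel functional calculus. Here a single spectral projection suffices. For U = A + i B with
  commuting Hermitian A and B, let S be the symmetry that is 1 on the subspace where A agrees with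
  sqrt (1 - B B) and -1 on its orthogonal complement (lemma hermitian_sign). Then
  S sqrt (1 - t^2 B B) + i t B is a path of unitaries from S to U, and S is joined to 1 through i S.
  The same lemma on signs provides the symmetry in the first part.

  The analytic tools are thus the orthogonal projection onto a closed subspace, the existence of
  adjoints, and the square root of 1 - X for norm X \<le> 1, which is 1 minus the norm limit
  of an iteration with a convergent scalar majorant and is continuous in X.
\<close>

instance chilbert_space \<subseteq> banach ..

section \<open>Geometry of complex inner product spaces\<close>

lemma cinner_add_right: "cinner x (y + z) = cinner x y + cinner x z"
  for x y z :: "'a::complex_inner"
  by (metis cinner_add_left cinner_commute complex_cnj_add)

lemma cinner_scaleC_right: "cinner x (c *\<^sub>C y) = cnj c * cinner x y"
  for x y :: "'a::complex_inner"
  by (metis cinner_commute cinner_scaleC_left complex_cnj_mult)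

lemma cinner_scaleR_left: "cinner (r *\<^sub>R x) y = of_real r * cinner x y"
  for x y :: "'a::complex_inner"
  by (simp add: scaleR_scaleC cinner_scaleC_left)

lemma cinner_scaleR_right: "cinner x (r *\<^sub>R y) = of_real r * cinner x y"
  for x y :: "'a::complex_inner"
  by (simp add: scaleR_scaleC cinner_scaleC_right)

lemma cinner_minus_left: "cinner (- x) y = - cinner x y"
  for x y :: "'a::complex_inner"
  using cinner_scaleR_left[of "-1" x y] by simp

lemma cinner_minus_right: "cinner x (- y) = - cinner x y"
  for x y :: "'a::complex_inner"
  using cinner_scaleR_right[of x "-1" y] by simp

lemma cinner_diff_left: "cinner (x - y) z = cinner x z - cinner y z"
  for x y z :: "'a::complex_inner"
  using cinner_add_left[of x "- y" z] by (simp add: cinner_minus_left)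

lemma cinner_diff_right: "cinner x (y - z) = cinner x y - cinner x z"
  for x y z :: "'a::complex_inner"
  using cinner_add_right[of x y "- z"] by (simp add: cinner_minus_right)

lemma cinner_zero_left: "cinner 0 y = 0" for y :: "'a::complex_inner"
  using cinner_scaleR_left[of 0 0 y] by simp

lemma cinner_zero_right: "cinner x 0 = 0" for x :: "'a::complex_inner"
  using cinner_scaleR_right[of x 0 0] by simp

lemmas cinner_simps = cinner_add_left cinner_add_right cinner_diff_left cinner_diff_right
  cinner_scaleC_left cinner_scaleC_right cinner_scaleR_left cinner_scaleR_right
  cinner_minus_left cinner_minus_right cinner_zero_left cinner_zero_right

lemma cinner_eq_zero_iff: "cinner x x = 0 \<longleftrightarrow> x = 0" for x :: "'a::complex_inner"
  by (simp add: cinner_self)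

lemma cinner_right_cancel:
  fixes x y :: "'a::complex_inner"
  assumes "\<And>z. cinner x z = cinner y z"
  shows "x = y"
proof -
  have "cinner (x - y) (x - y) = 0"
    using assms[of "x - y"] by (simp add: cinner_diff_left)
  then show ?thesis by (simp add: cinner_eq_zero_iff)
qed

lemma norm_add_squared:
  fixes x y :: "'a::complex_inner"
  shows "(norm (x + y))\<^sup>2 = (norm x)\<^sup>2 + (norm y)\<^sup>2 + 2 * Re (cinner x y)"
proof -
  have "complex_of_real ((norm (x + y))\<^sup>2) =
      of_real ((norm x)\<^sup>2) + of_real ((norm y)\<^sup>2) + (cinner x y + cnj (cinner x y))"
    unfolding cinner_self[symmetric] cinner_commute[of y x, symmetric]
    by (simp add: cinner_simps)
  then show ?thesis
    by (metis complex_add_cnj of_real_add of_real_eq_iff)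
qed

lemma norm_diff_squared:
  fixes x y :: "'a::complex_inner"
  shows "(norm (x - y))\<^sup>2 = (norm x)\<^sup>2 + (norm y)\<^sup>2 - 2 * Re (cinner x y)"
  using norm_add_squared[of x "- y"] by (simp add: cinner_minus_right)

lemma norm_scaleC: "norm (c *\<^sub>C x) = cmod c * norm x" for x :: "'a::complex_inner"
proof -
  have "complex_of_real ((norm (c *\<^sub>C x))\<^sup>2) = of_real ((cmod c * norm x)\<^sup>2)"
    unfolding cinner_self[symmetric] cinner_simps
    by (simp only: cinner_self power_mult_distrib of_real_mult complex_norm_square[of c] mult.assoc)
       (simp add: mult_ac)
  then have "(norm (c *\<^sub>C x))\<^sup>2 = (cmod c * norm x)\<^sup>2"
    by (simp only: of_real_eq_iff)
  then show ?thesis by (simp add: power2_eq_iff_nonneg)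
qed

lemma norm_diff_component_squared:
  fixes x y :: "'a::complex_inner"
  assumes "y \<noteq> 0"
  shows "(norm (x - (of_real (1 / (norm y)\<^sup>2) * cinner x y) *\<^sub>C y))\<^sup>2
    = (norm x)\<^sup>2 - (cmod (cinner x y))\<^sup>2 / (norm y)\<^sup>2"
proof -
  define c where "c = cinner x y"
  define r where "r = 1 / (norm y)\<^sup>2"
  have "cnj (of_real r * c) * c = of_real (r * (cmod c)\<^sup>2)"
    by (simp only: of_real_mult complex_norm_square[of c]) (simp add: mult_ac)
  then have "Re (cnj (of_real r * c) * c) = r * (cmod c)\<^sup>2" by (metis Re_complex_of_real)
  moreover have "\<bar>r\<bar> = r" by (simp add: r_def)
  ultimately have "(norm (x - (of_real r * c) *\<^sub>C y))\<^sup>2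
      = (norm x)\<^sup>2 + (r * cmod c * norm y)\<^sup>2 - 2 * (r * (cmod c)\<^sup>2)"
    by (simp only: norm_diff_squared norm_scaleC cinner_scaleC_right c_def[symmetric]
        norm_mult norm_of_real)
  also have "\<dots> = (norm x)\<^sup>2 - (cmod c)\<^sup>2 / (norm y)\<^sup>2"
    using assms by (simp add: r_def field_simps power2_eq_square)
  finally show ?thesis by (simp only: c_def r_def)
qed

lemma cmod_cinner_le: "cmod (cinner x y) \<le> norm x * norm y" for x y :: "'a::complex_inner"
proof (cases "y = 0")
  case True
  then show ?thesis by (simp add: cinner_zero_right)
next
  case False
  have "0 \<le> (norm x)\<^sup>2 - (cmod (cinner x y))\<^sup>2 / (norm y)\<^sup>2"
    unfolding norm_diff_component_squared[OF False, symmetric] by simp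
  then have "(cmod (cinner x y))\<^sup>2 \<le> (norm x * norm y)\<^sup>2"
    using False by (simp add: field_simps power_mult_distrib)
  then show ?thesis by (rule power2_le_imp_le) simp
qed

text \<open>With K the norm of an operator this bounds its adjoint; with K = 1 it bounds an orthogonal
  projection.\<close>

lemma norm_le_if_cinner_self_eq:
  fixes w y z :: "'a::complex_inner"
  assumes eq: "cinner z z = cinner w y" and w: "norm w \<le> K * norm z" and K: "0 \<le> K"
  shows "norm z \<le> K * norm y"
proof (cases "z = 0")
  case True
  then show ?thesis using K by simp
next
  case False
  have "(norm z)\<^sup>2 = cmod (cinner z z)" by (simp add: cinner_self norm_power)
  also have "\<dots> \<le> norm w * norm y" unfolding eq by (rule cmod_cinner_le)
  also have "\<dots> \<le> (K * norm z) * norm y" by (intro mult_right_mono w) simp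
  finally have "norm z * norm z \<le> (K * norm y) * norm z" by (simp add: power2_eq_square mult_ac)
  with False show ?thesis by simp
qed

lemma bounded_linear_cinner_left: "bounded_linear (\<lambda>x. cinner x y)" for y :: "'a::complex_inner"
  by (rule bounded_linear_intro[where K = "norm y"])
    (simp_all add: cinner_simps cmod_cinner_le scaleR_conv_of_real)

lemma bounded_linear_cinner_right: "bounded_linear (\<lambda>y. cinner x y)" for x :: "'a::complex_inner"
  by (rule bounded_linear_intro[where K = "norm x"])
    (simp_all add: cinner_simps scaleR_conv_of_real, metis cmod_cinner_le mult.commute)

lemma bounded_linear_scaleC: "bounded_linear (\<lambda>x::'a::complex_inner. c *\<^sub>C x)"
  by (rule bounded_linear_intro[where K = "cmod c"])
    (simp_all add: norm_scaleC scaleC_add_right scaleR_scaleC scaleC_scaleC mult.commute[of _ c]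
      mult.commute[of _ "cmod c"])

section \<open>Orthogonal projection and adjoints\<close>

definition closed_csubspace :: "'a::complex_inner set \<Rightarrow> bool" where
  "closed_csubspace M \<longleftrightarrow> closed M \<and> 0 \<in> M \<and> (\<forall>x\<in>M. \<forall>y\<in>M. x + y \<in> M) \<and> (\<forall>c. \<forall>x\<in>M. c *\<^sub>C x \<in> M)"

text \<open>Closed bounded sets need not be compact here, so the minimum is not attained for that reason;
  instead a minimizing sequence is Cauchy by the parallelogram law, and the space is complete.\<close>

lemma closed_csubspace_nearest_point:
  fixes M :: "'a::chilbert_space set"
  assumes M: "closed_csubspace M"
  obtains m where "m \<in> M" "\<And>y. y \<in> M \<Longrightarrow> norm (x - m) \<le> norm (x - y)"
proof -
  define d where "d = infdist x M"
  have ne: "M \<noteq> {}" and cl: "closed M" using M by (auto simp: closed_csubspace_def)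
  have low: "d \<le> norm (x - y)" if "y \<in> M" for y
    using infdist_le[OF that, of x] by (simp add: d_def dist_norm)
  have d0: "0 \<le> d" by (simp add: d_def infdist_nonneg)
  have "\<exists>y\<in>M. norm (x - y) < d + inverse (real (Suc n))" for n
  proof (rule ccontr)
    assume "\<not> ?thesis"
    then have "d + inverse (real (Suc n)) \<le> infdist x M"
      using ne by (subst infdist_notempty) (auto intro!: cINF_greatest simp: dist_norm not_less)
    then show False by (simp add: d_def)
  qed
  then obtain u where uM: "\<And>n. u n \<in> M"
      and u: "\<And>n. norm (x - u n) < d + inverse (real (Suc n))" by metis
  have lim: "(\<lambda>n. norm (x - u n)) \<longlonglongrightarrow> d"
  proof (rule tendsto_sandwich[where f = "\<lambda>_. d" and h = "\<lambda>n. d + inverse (real (Suc n))"])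
    show "(\<lambda>n. d + inverse (real (Suc n))) \<longlonglongrightarrow> d"
      using tendsto_add[OF tendsto_const LIMSEQ_inverse_real_of_nat] by simp
    show "\<forall>\<^sub>F n in sequentially. d \<le> norm (x - u n)"
      by (intro always_eventually allI low uM)
    show "\<forall>\<^sub>F n in sequentially. norm (x - u n) \<le> d + inverse (real (Suc n))"
      by (intro always_eventually allI less_imp_le u)
  qed simp
  \<comment> \<open>The midpoint of two points of M is again at distance at least d, so the parallelogram law
    makes two almost nearest points close to each other.\<close>
  have par: "(dist (u m) (u n))\<^sup>2 \<le> 2 * (norm (x - u m))\<^sup>2 + 2 * (norm (x - u n))\<^sup>2 - 4 * d\<^sup>2" for m n
  proof -
    have "(1/2) *\<^sub>R (u m + u n) \<in> M"
      using M uM by (auto simp: closed_csubspace_def scaleR_scaleC)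
    then have "d \<le> norm (x - (1/2) *\<^sub>R (u m + u n))" by (rule low)
    also have "x - (1/2) *\<^sub>R (u m + u n) = (1/2) *\<^sub>R ((x - u m) + (x - u n))"
    proof -
      have "(1/2) *\<^sub>R x + (1/2) *\<^sub>R x = x" by (simp flip: scaleR_left_distrib)
      then show ?thesis by (simp add: scaleR_right_distrib scaleR_diff_right algebra_simps)
    qed
    finally have "2 * d \<le> norm ((x - u m) + (x - u n))" by simp
    then have "(2 * d)\<^sup>2 \<le> (norm ((x - u m) + (x - u n)))\<^sup>2"
      using d0 by (intro power_mono) auto
    moreover have "dist (u m) (u n) = norm ((x - u m) - (x - u n))"
      by (simp add: dist_norm norm_minus_commute)
    ultimately show ?thesis
      using norm_add_squared[of "x - u m" "x - u n"] norm_diff_squared[of "x - u m" "x - u n"]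
      by (simp add: power_mult_distrib)
  qed
  have "Cauchy u"
  proof (rule metric_CauchyI)
    fix e :: real assume e: "0 < e"
    have "(\<lambda>n. (norm (x - u n))\<^sup>2) \<longlonglongrightarrow> d\<^sup>2" by (intro tendsto_power lim)
    then have "\<forall>\<^sub>F n in sequentially. (norm (x - u n))\<^sup>2 < d\<^sup>2 + e\<^sup>2 / 4"
      using e by (intro order_tendstoD) auto
    then obtain N where N: "\<And>n. n \<ge> N \<Longrightarrow> (norm (x - u n))\<^sup>2 < d\<^sup>2 + e\<^sup>2 / 4"
      by (auto simp: eventually_sequentially)
    have "dist (u m) (u n) < e" if "m \<ge> N" "n \<ge> N" for m n
    proof (rule power2_less_imp_less)
      show "(dist (u m) (u n))\<^sup>2 < e\<^sup>2"
        using par[of m n] N[OF that(1)] N[OF that(2)] by linarith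
    qed (use e in simp)
    then show "\<exists>N. \<forall>m\<ge>N. \<forall>n\<ge>N. dist (u m) (u n) < e" by blast
  qed
  then obtain m where m: "u \<longlonglongrightarrow> m" using Cauchy_convergent_iff convergent_def by blast
  have "m \<in> M" by (rule closed_sequentially[OF cl uM m])
  moreover have "(\<lambda>n. norm (x - u n)) \<longlonglongrightarrow> norm (x - m)" by (intro tendsto_intros m)
  then have "norm (x - m) = d" using lim LIMSEQ_unique by blast
  ultimately show ?thesis using that low by simp
qed

lemma orthogonal_decomposition:
  fixes M :: "'a::chilbert_space set"
  assumes M: "closed_csubspace M"
  obtains m where "m \<in> M" "\<And>y. y \<in> M \<Longrightarrow> cinner (x - m) y = 0"
proof -
  obtain m where m: "m \<in> M" and min: "\<And>y. y \<in> M \<Longrightarrow> norm (x - m) \<le> norm (x - y)"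
    using closed_csubspace_nearest_point[OF M, of x] by blast
  have "cinner (x - m) y = 0" if y: "y \<in> M" for y
  proof (cases "y = 0")
    case True
    then show ?thesis by (simp add: cinner_zero_right)
  next
    case False
    \<comment> \<open>Compare the minimal distance with the one obtained after subtracting the component along y.\<close>
    let ?c = "cinner (x - m) y"
    let ?v = "(of_real (1 / (norm y)\<^sup>2) * ?c) *\<^sub>C y"
    have "m + ?v \<in> M" using M m y by (auto simp: closed_csubspace_def)
    from min[OF this] have "(norm (x - m))\<^sup>2 \<le> (norm ((x - m) - ?v))\<^sup>2"
      by (simp add: diff_diff_add power_mono)
    also have "\<dots> = (norm (x - m))\<^sup>2 - (cmod ?c)\<^sup>2 / (norm y)\<^sup>2"
      by (rule norm_diff_component_squared[OF False])
    finally have "(cmod ?c)\<^sup>2 \<le> 0" using False by (simp add: divide_le_0_iff)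
    then show ?thesis by simp
  qed
  with m that show ?thesis by blast
qed

lemma riesz_representation:
  fixes f :: "'a::chilbert_space \<Rightarrow> complex"
  assumes bl: "bounded_linear f" and lin: "\<And>c x. f (c *\<^sub>C x) = c * f x"
  obtains z where "\<And>x. f x = cinner x z"
proof (cases "\<forall>x. f x = 0")
  case True
  then show ?thesis using that[of 0] by (simp add: cinner_zero_right)
next
  case False
  then obtain x where x: "f x \<noteq> 0" by blast
  interpret bounded_linear f by (rule bl)
  have "closed_csubspace (f -` {0})"
    by (auto simp: closed_csubspace_def add lin zero intro!: closed_vimage
        linear_continuous_on bl)
  then obtain m where m: "f m = 0" and ort: "\<And>y. f y = 0 \<Longrightarrow> cinner (x - m) y = 0"
    using orthogonal_decomposition[of "f -` {0}" x] by (metis vimage_singleton_eq)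
  define w where "w = x - m"
  have fw: "f w \<noteq> 0" using x m by (simp add: w_def diff)
  then have w0: "cinner w w \<noteq> 0" using zero by (auto simp: cinner_eq_zero_iff)
  have "f y = cinner y (cnj (f w / cinner w w) *\<^sub>C w)" for y
  proof -
    have "f (f w *\<^sub>C y - f y *\<^sub>C w) = 0" by (simp add: diff lin)
    from ort[OF this] have "cinner (f w *\<^sub>C y - f y *\<^sub>C w) w = 0"
      by (metis cinner_commute complex_cnj_zero w_def)
    then have "f w * cinner y w = f y * cinner w w" by (simp add: cinner_simps)
    then show ?thesis using w0 by (simp add: cinner_simps field_simps)
  qed
  then show ?thesis by (rule that)
qed

lemma blinfun_compose_assoc: "(A o\<^sub>L B) o\<^sub>L C = A o\<^sub>L (B o\<^sub>L C)"
  by (rule blinfun_eqI) simp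

lemma blinfun_compose_id: "A o\<^sub>L id_blinfun = A" "id_blinfun o\<^sub>L A = A"
  by (rule blinfun_eqI, simp)+

text \<open>The relation avoids the definite description in \<^const>\<open>cadjoint\<close>: a pair of real-linear
  operators related in this way consists of complex-linear ones, and membership in
  \<^const>\<open>projections\<close> or \<^const>\<open>unitary_ops\<close> becomes an equation between inner products.\<close>

definition is_adjoint :: "('a::chilbert_space \<Rightarrow>\<^sub>L 'a) \<Rightarrow> ('a \<Rightarrow>\<^sub>L 'a) \<Rightarrow> bool" where
  "is_adjoint A B \<longleftrightarrow> (\<forall>x y. cinner (blinfun_apply A x) y = cinner x (blinfun_apply B y))"

abbreviation hermitian :: "('a::chilbert_space \<Rightarrow>\<^sub>L 'a) \<Rightarrow> bool" where
  "hermitian A \<equiv> is_adjoint A A"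

lemma is_adjointD: "is_adjoint A B \<Longrightarrow> cinner (blinfun_apply A x) y = cinner x (blinfun_apply B y)"
  by (simp add: is_adjoint_def)

lemma is_adjoint_sym: "is_adjoint A B \<Longrightarrow> is_adjoint B A"
proof -
  assume A: "is_adjoint A B"
  have "cinner (blinfun_apply B x) y = cinner x (blinfun_apply A y)" for x y
    unfolding cinner_commute[of _ y] cinner_commute[of x] is_adjointD[OF A] ..
  then show ?thesis by (simp add: is_adjoint_def)
qed

lemma is_adjoint_bounded_ops: "is_adjoint A B \<Longrightarrow> A \<in> bounded_ops"
  unfolding bounded_ops_def mem_Collect_eq
  by (intro allI, rule cinner_right_cancel) (simp add: is_adjoint_def cinner_scaleC_left)

lemma is_adjoint_unique:
  assumes "is_adjoint A B" "is_adjoint A C"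
  shows "B = C"
  by (rule blinfun_eqI, rule cinner_right_cancel)
    (simp add: assms[THEN is_adjoint_sym, THEN is_adjointD])

lemma is_adjoint_norm_le:
  assumes "is_adjoint A B"
  shows "norm B \<le> norm A"
proof (rule norm_blinfun_bound)
  fix y
  show "norm (blinfun_apply B y) \<le> norm A * norm y"
    by (rule norm_le_if_cinner_self_eq[OF _ norm_blinfun[of A "blinfun_apply B y"]])
      (simp_all add: is_adjointD[OF assms])
qed simp

text \<open>Riesz representation of the functional x \<mapsto> \<langle>A x, y\<rangle> gives the value of the adjoint
  at y. Existence matters even for projections: without it the equation cadjoint P = P would say
  nothing about P.\<close>

lemma is_adjoint_exists:
  assumes A: "A \<in> bounded_ops"
  shows "\<exists>B. is_adjoint A B"
proof -
  have "\<exists>z. \<forall>x. cinner (blinfun_apply A x) y = cinner x z" for y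
  proof -
    have "bounded_linear (\<lambda>x. cinner (blinfun_apply A x) y)"
      by (rule bounded_linear_compose[OF bounded_linear_cinner_left]) (rule blinfun.bounded_linear_right)
    then show ?thesis
      using A by (elim riesz_representation) (auto simp: bounded_ops_def cinner_scaleC_left)
  qed
  then obtain b where b: "\<And>x y. cinner (blinfun_apply A x) y = cinner x (b y)" by metis
  have b': "cinner (b y) x = cinner y (blinfun_apply A x)" for x y
    unfolding cinner_commute[of _ x] cinner_commute[of y] b ..
  have "bounded_linear b"
  proof (rule bounded_linear_intro[where K = "norm A"])
    fix y
    show "norm (b y) \<le> norm y * norm A"
      unfolding mult.commute[of "norm y"]
      by (rule norm_le_if_cinner_self_eq[OF _ norm_blinfun[of A "b y"]]) (simp_all add: b)
  qed (rule cinner_right_cancel, simp add: cinner_simps b')+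
  then have "is_adjoint A (Blinfun b)"
    by (simp add: is_adjoint_def bounded_linear_Blinfun_apply b)
  then show ?thesis by blast
qed

lemma cadjoint_eqI:
  assumes "is_adjoint A B"
  shows "cadjoint A = B"
  unfolding cadjoint_def is_adjoint_def[symmetric]
  using assms is_adjoint_bounded_ops is_adjoint_sym is_adjoint_unique
  by (intro the_equality) blast+

lemma is_adjoint_cadjoint: "A \<in> bounded_ops \<Longrightarrow> is_adjoint A (cadjoint A)"
  using is_adjoint_exists cadjoint_eqI by metis

lemma projections_iff: "P \<in> projections \<longleftrightarrow> hermitian P \<and> P o\<^sub>L P = P"
proof
  assume "P \<in> projections"
  then show "hermitian P \<and> P o\<^sub>L P = P"
    using is_adjoint_cadjoint[of P] by (simp add: projections_def)
next
  assume P: "hermitian P \<and> P o\<^sub>L P = P"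
  then have "P \<in> bounded_ops" "cadjoint P = P"
    by (blast intro: is_adjoint_bounded_ops cadjoint_eqI)+
  with P show "P \<in> projections" by (simp add: projections_def)
qed

lemma unitary_ops_iff:
  "W \<in> unitary_ops \<longleftrightarrow> (\<exists>V. is_adjoint W V \<and> V o\<^sub>L W = id_blinfun \<and> W o\<^sub>L V = id_blinfun)"
    (is "_ = ?R")
proof
  assume "W \<in> unitary_ops"
  then show ?R
    using is_adjoint_cadjoint[of W] unfolding unitary_ops_def by blast
next
  assume ?R
  then obtain V where V: "is_adjoint W V" "V o\<^sub>L W = id_blinfun" "W o\<^sub>L V = id_blinfun"
    by blast
  then have "W \<in> bounded_ops" "cadjoint W = V"
    by (blast intro: is_adjoint_bounded_ops cadjoint_eqI)+
  with V show "W \<in> unitary_ops" by (simp add: unitary_ops_def)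
qed

lemma is_adjoint_id: "hermitian id_blinfun"
  by (simp add: is_adjoint_def)

lemma is_adjoint_compose:
  "is_adjoint A A' \<Longrightarrow> is_adjoint B B' \<Longrightarrow> is_adjoint (A o\<^sub>L B) (B' o\<^sub>L A')"
  by (simp add: is_adjoint_def)

lemma is_adjoint_add: "is_adjoint A A' \<Longrightarrow> is_adjoint B B' \<Longrightarrow> is_adjoint (A + B) (A' + B')"
  by (simp add: is_adjoint_def blinfun.add_left cinner_simps)

lemma is_adjoint_diff: "is_adjoint A A' \<Longrightarrow> is_adjoint B B' \<Longrightarrow> is_adjoint (A - B) (A' - B')"
  by (simp add: is_adjoint_def blinfun.diff_left cinner_simps)

lemma is_adjoint_scaleR: "is_adjoint A A' \<Longrightarrow> is_adjoint (r *\<^sub>R A) (r *\<^sub>R A')"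
  by (simp add: is_adjoint_def blinfun.scaleR_left cinner_simps)

lemmas is_adjoint_intros = is_adjoint_id is_adjoint_compose is_adjoint_add is_adjoint_diff
  is_adjoint_scaleR

lemma hermitian_limit:
  assumes "\<And>n::nat. hermitian (F n)" "F \<longlonglongrightarrow> A"
  shows "hermitian A"
  unfolding is_adjoint_def
proof (intro allI)
  fix x y
  have F: "(\<lambda>n. blinfun_apply (F n) z) \<longlonglongrightarrow> blinfun_apply A z" for z
    by (intro blinfun.tendsto assms tendsto_const)
  have "(\<lambda>n. cinner (blinfun_apply (F n) x) y) \<longlonglongrightarrow> cinner (blinfun_apply A x) y"
    by (rule bounded_linear.tendsto[OF bounded_linear_cinner_left F])
  moreover have "(\<lambda>n. cinner x (blinfun_apply (F n) y)) \<longlonglongrightarrow> cinner x (blinfun_apply A y)"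
    by (rule bounded_linear.tendsto[OF bounded_linear_cinner_right F])
  moreover have "(\<lambda>n. cinner (blinfun_apply (F n) x) y) = (\<lambda>n. cinner x (blinfun_apply (F n) y))"
    using assms(1) by (simp add: is_adjoint_def)
  ultimately show "cinner (blinfun_apply A x) y = cinner x (blinfun_apply A y)"
    using LIMSEQ_unique by auto
qed

text \<open>The vector given by the orthogonal decomposition depends linearly on x because it is
  determined by its inner products, and it has norm at most norm x.\<close>

lemma projection_onto_exists:
  fixes M :: "'a::chilbert_space set"
  assumes M: "closed_csubspace M"
  obtains E where "hermitian E" "\<And>x. blinfun_apply E x \<in> M" "\<And>x. x \<in> M \<Longrightarrow> blinfun_apply E x = x"
proof -
  have "\<exists>m. m \<in> M \<and> (\<forall>y\<in>M. cinner (x - m) y = 0)" for x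
    using orthogonal_decomposition[OF M, of x] by metis
  then obtain p where pM: "\<And>x. p x \<in> M" and p: "\<And>x y. y \<in> M \<Longrightarrow> cinner (x - p x) y = 0"
    by metis
  have p1: "cinner (p x) y = cinner x y" if "y \<in> M" for x y
    using p[OF that, of x] by (simp add: cinner_simps)
  have herm: "cinner (p x) y = cinner x (p y)" for x y
    using p1[OF pM, of x y] p1[OF pM, of y x] by (metis cinner_commute)
  have "bounded_linear p"
  proof (rule bounded_linear_intro[where K = 1])
    fix x
    show "norm (p x) \<le> norm x * 1"
    proof -
      have "cinner (p x) (p x) = cinner (p x) x"
        unfolding cinner_commute[of "p x" x] p1[OF pM, of x x, symmetric] cinner_self by simp
      from norm_le_if_cinner_self_eq[OF this, of 1] show ?thesis by simp
    qed
  qed (rule cinner_right_cancel, simp add: cinner_simps herm)+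
  note [simp] = bounded_linear_Blinfun_apply[OF this]
  have "p x = x" if x: "x \<in> M" for x
  proof -
    have "x - p x = x + (-1) *\<^sub>C p x"
      using scaleR_scaleC[of "-1" "p x"] by simp
    also have "\<dots> \<in> M" using M x pM[of x] by (simp add: closed_csubspace_def)
    finally have "cinner (x - p x) (x - p x) = 0" by (rule p)
    then show ?thesis by (simp add: cinner_eq_zero_iff)
  qed
  then show ?thesis
    using that[of "Blinfun p"] by (simp add: is_adjoint_def herm pM)
qed

section \<open>Square roots near the identity\<close>

text \<open>The operator Y = 1 - sqrt (1 - X) is a fixed point of Y \<mapsto> (X + Y Y) / 2, and it is obtained
  by iterating this map from 0. All square roots that occur are of this form with the norm of X at
  most 1.\<close>

primrec sqrt_iter :: "('a::chilbert_space \<Rightarrow>\<^sub>L 'a) \<Rightarrow> nat \<Rightarrow> ('a \<Rightarrow>\<^sub>L 'a)" where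
  "sqrt_iter X 0 = 0"
| "sqrt_iter X (Suc n) = (1/2) *\<^sub>R (X + (sqrt_iter X n o\<^sub>L sqrt_iter X n))"

text \<open>The same iteration for the number X = 1. It increases to the fixed point 1, and it majorizes
  the iterates and their increments for every X in the closed unit ball. This gives norm
  convergence, uniformly in X, including the boundary norm X = 1 where a contraction argument
  fails.\<close>

primrec sqrt_majorant :: "nat \<Rightarrow> real" where
  "sqrt_majorant 0 = 0"
| "sqrt_majorant (Suc n) = (1 + (sqrt_majorant n)\<^sup>2) / 2"

lemma sqrt_majorant_bounds: "0 \<le> sqrt_majorant n \<and> sqrt_majorant n \<le> 1"
proof (induction n)
  case (Suc n)
  then have "(sqrt_majorant n)\<^sup>2 \<le> 1" by (simp add: power_le_one)
  then show ?case by simp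
qed simp

lemma incseq_sqrt_majorant: "incseq sqrt_majorant"
proof (rule incseq_SucI)
  fix n
  have "0 \<le> (1 - sqrt_majorant n)\<^sup>2" by simp
  then show "sqrt_majorant n \<le> sqrt_majorant (Suc n)"
    by (simp add: power2_eq_square algebra_simps)
qed

lemma sqrt_majorant_Cauchy: "Cauchy sqrt_majorant"
  using incseq_convergent[OF incseq_sqrt_majorant, of 1] sqrt_majorant_bounds
  by (metis LIMSEQ_imp_Cauchy)

lemma norm_sqrt_iter_le:
  assumes X: "norm X \<le> 1"
  shows "norm (sqrt_iter X n) \<le> sqrt_majorant n"
proof (induction n)
  case (Suc n)
  have "norm (sqrt_iter X n o\<^sub>L sqrt_iter X n) \<le> norm (sqrt_iter X n) * norm (sqrt_iter X n)"
    by (rule norm_blinfun_compose)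
  also have "\<dots> \<le> (sqrt_majorant n)\<^sup>2"
    unfolding power2_eq_square using Suc sqrt_majorant_bounds by (intro mult_mono) auto
  finally have "norm (X + (sqrt_iter X n o\<^sub>L sqrt_iter X n)) \<le> 1 + (sqrt_majorant n)\<^sup>2"
    using X norm_triangle_ineq by (smt (verit))
  then show ?case by simp
qed simp

lemma blinfun_square_diff:
  "(A o\<^sub>L A) - (B o\<^sub>L B) = (A o\<^sub>L (A - B)) + ((A - B) o\<^sub>L B)"
  by (rule blinfun_eqI) (simp add: blinfun.bilinear_simps)

text \<open>The identity a a - b b = a (a - b) + (a - b) b holds without commutativity. It turns the
  bounds on two consecutive iterates and on their difference into a bound on the next difference.\<close>

lemma norm_sqrt_iter_Suc_diff:
  assumes X: "norm X \<le> 1"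
  shows "norm (sqrt_iter X (Suc n) - sqrt_iter X n) \<le> sqrt_majorant (Suc n) - sqrt_majorant n"
proof (induction n)
  case 0
  then show ?case using X by simp
next
  case (Suc n)
  define A B where "A = sqrt_iter X (Suc n)" and "B = sqrt_iter X n"
  define a b where "a = sqrt_majorant (Suc n)" and "b = sqrt_majorant n"
  have A: "norm A \<le> a" and B: "norm B \<le> b"
    unfolding A_def B_def a_def b_def by (rule norm_sqrt_iter_le[OF X])+
  have a0: "0 \<le> a" "0 \<le> b" unfolding a_def b_def using sqrt_majorant_bounds by blast+
  have IH: "norm (A - B) \<le> a - b" unfolding A_def B_def a_def b_def by (rule Suc.IH)
  have "norm ((A o\<^sub>L (A - B)) + ((A - B) o\<^sub>L B)) \<le> norm A * norm (A - B) + norm (A - B) * norm B"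
    by (intro order_trans[OF norm_triangle_ineq] add_mono norm_blinfun_compose)
  also have "\<dots> \<le> a * (a - b) + (a - b) * b"
    using A B IH a0 order_trans[OF norm_ge_zero IH] by (intro add_mono mult_mono) auto
  finally have "norm ((A o\<^sub>L A) - (B o\<^sub>L B)) \<le> a\<^sup>2 - b\<^sup>2"
    by (simp add: blinfun_square_diff power2_eq_square algebra_simps)
  moreover have "sqrt_iter X (Suc (Suc n)) - sqrt_iter X (Suc n) = (1/2) *\<^sub>R ((A o\<^sub>L A) - (B o\<^sub>L B))"
    unfolding sqrt_iter.simps(2)[of X "Suc n"] A_def[symmetric]
    by (simp add: A_def B_def algebra_simps)
  moreover have "sqrt_majorant (Suc (Suc n)) - sqrt_majorant (Suc n) = (a\<^sup>2 - b\<^sup>2) / 2"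
    unfolding sqrt_majorant.simps(2)[of "Suc n"] a_def[symmetric]
    by (simp add: a_def b_def field_simps)
  ultimately show ?case by simp
qed

lemma norm_sqrt_iter_diff:
  assumes X: "norm X \<le> 1" and mn: "n \<le> m"
  shows "norm (sqrt_iter X m - sqrt_iter X n) \<le> sqrt_majorant m - sqrt_majorant n"
  using mn
proof (induction rule: dec_induct)
  case (step k)
  have "norm (sqrt_iter X (Suc k) - sqrt_iter X n)
      \<le> norm (sqrt_iter X (Suc k) - sqrt_iter X k) + norm (sqrt_iter X k - sqrt_iter X n)"
    by (metis diff_add_cancel add_diff_eq norm_triangle_ineq)
  then show ?case using step.IH norm_sqrt_iter_Suc_diff[OF X, of k] by linarith
qed simp

definition sqrt_one_minus :: "('a::chilbert_space \<Rightarrow>\<^sub>L 'a) \<Rightarrow> ('a \<Rightarrow>\<^sub>L 'a)" where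
  "sqrt_one_minus X = id_blinfun - lim (sqrt_iter X)"

lemma sqrt_iter_uniform_limit:
  "uniform_limit (cball 0 1) (\<lambda>n X. sqrt_iter X n) (\<lambda>X. lim (sqrt_iter X)) sequentially"
proof -
  have "uniformly_Cauchy_on (cball 0 1) (\<lambda>n (X::'a \<Rightarrow>\<^sub>L 'a). sqrt_iter X n)"
  proof (rule uniformly_Cauchy_onI)
    fix e :: real assume "0 < e"
    then obtain N where N: "\<And>m n. m \<ge> N \<Longrightarrow> n \<ge> N \<Longrightarrow> dist (sqrt_majorant m) (sqrt_majorant n) < e"
      using sqrt_majorant_Cauchy metric_CauchyD by blast
    have "dist (sqrt_iter X m) (sqrt_iter X n) < e"
      if X: "norm X \<le> 1" and "m \<ge> N" "n \<ge> N" for X :: "'a \<Rightarrow>\<^sub>L 'a" and m n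
    proof (cases "n \<le> m")
      case True
      then show ?thesis
        using norm_sqrt_iter_diff[OF X True] N[OF that(2,3)] by (simp add: dist_norm)
    next
      case False
      then show ?thesis
        using norm_sqrt_iter_diff[OF X, of m n] N[OF that(2,3)]
        by (simp add: dist_norm norm_minus_commute abs_minus_commute)
    qed
    then show "\<exists>M. \<forall>X\<in>cball (0::'a \<Rightarrow>\<^sub>L 'a) 1. \<forall>m\<ge>M. \<forall>n\<ge>M. dist (sqrt_iter X m) (sqrt_iter X n) < e"
      by (intro exI[of _ N]) simp
  qed
  then have "uniformly_convergent_on (cball 0 1) (\<lambda>n (X::'a \<Rightarrow>\<^sub>L 'a). sqrt_iter X n)"
    by (rule Cauchy_uniformly_convergent)
  then show ?thesis by (simp add: uniformly_convergent_uniform_limit_iff)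
qed

lemma sqrt_iter_tendsto:
  assumes "norm X \<le> 1"
  shows "sqrt_iter X \<longlonglongrightarrow> id_blinfun - sqrt_one_minus X"
  using tendsto_uniform_limitI[OF sqrt_iter_uniform_limit, of X] assms
  by (simp add: sqrt_one_minus_def)

lemma continuous_on_sqrt_one_minus: "continuous_on (cball 0 1) sqrt_one_minus"
proof -
  have "continuous_on (cball 0 1) (\<lambda>X::'a \<Rightarrow>\<^sub>L 'a. sqrt_iter X n)" for n
    by (induction n)
      (auto intro!: continuous_intros bounded_bilinear.continuous_on[OF bounded_bilinear_blinfun_compose])
  then have "continuous_on (cball 0 1) (\<lambda>X::'a \<Rightarrow>\<^sub>L 'a. lim (sqrt_iter X))"
    by (intro uniform_limit_theorem[OF _ sqrt_iter_uniform_limit]) auto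
  then show ?thesis
    unfolding sqrt_one_minus_def by (intro continuous_intros)
qed

lemma sqrt_one_minus_square:
  assumes X: "norm X \<le> 1"
  shows "sqrt_one_minus X o\<^sub>L sqrt_one_minus X = id_blinfun - X"
proof -
  define Y where "Y = id_blinfun - sqrt_one_minus X"
  note lim = sqrt_iter_tendsto[OF X, folded Y_def]
  have "(\<lambda>n. sqrt_iter X (Suc n)) \<longlonglongrightarrow> (1/2) *\<^sub>R (X + (Y o\<^sub>L Y))"
    unfolding sqrt_iter.simps
    by (intro tendsto_intros lim bounded_bilinear.tendsto[OF bounded_bilinear_blinfun_compose])
  moreover have "(\<lambda>n. sqrt_iter X (Suc n)) \<longlonglongrightarrow> Y" using lim by (rule LIMSEQ_Suc)
  ultimately have "Y = (1/2) *\<^sub>R (X + (Y o\<^sub>L Y))" by (rule LIMSEQ_unique[symmetric])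
  then have "Y + Y = X + (Y o\<^sub>L Y)"
    by (metis scaleR_half_double scaleR_right_distrib)
  then have YY: "Y o\<^sub>L Y = Y + Y - X" by simp
  have "sqrt_one_minus X o\<^sub>L sqrt_one_minus X = id_blinfun - Y - Y + (Y o\<^sub>L Y)"
    by (rule blinfun_eqI) (simp add: Y_def blinfun.bilinear_simps)
  then show ?thesis by (simp add: YY)
qed

lemma hermitian_sqrt_one_minus:
  assumes "norm X \<le> 1" "hermitian X"
  shows "hermitian (sqrt_one_minus X)"
proof -
  have "hermitian (sqrt_iter X n)" for n
    using assms(2) by (induction n) (simp_all add: is_adjoint_intros, simp add: is_adjoint_def blinfun.zero_left cinner_simps)
  then have "hermitian (id_blinfun - sqrt_one_minus X)"
    using sqrt_iter_tendsto[OF assms(1)] by (rule hermitian_limit)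
  from is_adjoint_diff[OF is_adjoint_id this] show ?thesis by simp
qed

lemma sqrt_one_minus_commute:
  assumes X: "norm X \<le> 1" and T: "T o\<^sub>L X = X o\<^sub>L T"
  shows "T o\<^sub>L sqrt_one_minus X = sqrt_one_minus X o\<^sub>L T"
proof -
  let ?Y = "id_blinfun - sqrt_one_minus X"
  have iter: "T o\<^sub>L sqrt_iter X n = sqrt_iter X n o\<^sub>L T" for n
  proof (induction n)
    case (Suc n)
    have "blinfun_apply T (blinfun_apply X z) = blinfun_apply X (blinfun_apply T z)"
      "blinfun_apply T (blinfun_apply (sqrt_iter X n) z) = blinfun_apply (sqrt_iter X n) (blinfun_apply T z)" for z
      using T Suc by (metis blinfun_apply_blinfun_compose)+
    then show ?case by (intro blinfun_eqI) (simp add: blinfun.bilinear_simps)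
  qed simp
  have "(\<lambda>n. T o\<^sub>L sqrt_iter X n) \<longlonglongrightarrow> (T o\<^sub>L ?Y)"
    by (intro bounded_bilinear.tendsto[OF bounded_bilinear_blinfun_compose] tendsto_const
        sqrt_iter_tendsto X)
  moreover have "(\<lambda>n. T o\<^sub>L sqrt_iter X n) \<longlonglongrightarrow> (?Y o\<^sub>L T)"
    unfolding iter
    by (intro bounded_bilinear.tendsto[OF bounded_bilinear_blinfun_compose] tendsto_const
        sqrt_iter_tendsto X)
  ultimately have eq: "T o\<^sub>L ?Y = ?Y o\<^sub>L T" by (rule LIMSEQ_unique)
  have "blinfun_apply (T o\<^sub>L ?Y) z = blinfun_apply (?Y o\<^sub>L T) z" for z
    unfolding eq ..
  then show ?thesis by (intro blinfun_eqI) (simp add: blinfun.bilinear_simps)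
qed

lemma sqrt_one_minus_zero: "sqrt_one_minus 0 = id_blinfun"
proof -
  have "sqrt_iter (0::'a \<Rightarrow>\<^sub>L 'a) n = 0" for n by (induction n) simp_all
  then have "(\<lambda>n. sqrt_iter (0::'a \<Rightarrow>\<^sub>L 'a) n) \<longlonglongrightarrow> 0" by (simp only:) (rule tendsto_const)
  from LIMSEQ_unique[OF sqrt_iter_tendsto this]
  have "id_blinfun - sqrt_one_minus 0 = (0::'a \<Rightarrow>\<^sub>L 'a)" by simp
  then show ?thesis by simp
qed

section \<open>The sign of a Hermitian operator\<close>

text \<open>This is the substitute for the spectral theorem. The operator R plays the role of the
  absolute value of A: on the kernel of R - A the two agree, and on the orthogonal complement of this
  kernel they are opposite. The symmetry S that is 1 on the kernel and -1 on the complement is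
  therefore a sign of A. A Hermitian T that commutes with A and R maps the kernel into itself, and
  hence commutes with S.\<close>

lemma hermitian_sign:
  fixes A R :: "'a::chilbert_space \<Rightarrow>\<^sub>L 'a"
  assumes A: "hermitian A" and R: "hermitian R" and comm: "A o\<^sub>L R = R o\<^sub>L A"
    and square: "R o\<^sub>L R = A o\<^sub>L A"
  obtains S where "hermitian S" "S o\<^sub>L S = id_blinfun" "S o\<^sub>L R = A"
    "\<And>T. hermitian T \<Longrightarrow> T o\<^sub>L A = A o\<^sub>L T \<Longrightarrow> T o\<^sub>L R = R o\<^sub>L T \<Longrightarrow> T o\<^sub>L S = S o\<^sub>L T"
proof -
  define M where "M = {x. blinfun_apply R x = blinfun_apply A x}"
  have lin: "blinfun_apply A (c *\<^sub>C x) = c *\<^sub>C blinfun_apply A x"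
    "blinfun_apply R (c *\<^sub>C x) = c *\<^sub>C blinfun_apply R x" for c x
    using is_adjoint_bounded_ops[OF A] is_adjoint_bounded_ops[OF R] by (auto simp: bounded_ops_def)
  have "closed_csubspace M"
    unfolding closed_csubspace_def M_def
    by (auto simp: blinfun.bilinear_simps lin intro!: closed_Collect_eq continuous_intros)
  then obtain E where E: "hermitian E" and EM: "\<And>x. blinfun_apply E x \<in> M"
    and Eid: "\<And>x. x \<in> M \<Longrightarrow> blinfun_apply E x = x"
    using projection_onto_exists by blast
  \<comment> \<open>A Hermitian operator that leaves M invariant leaves its orthogonal complement invariant,
    so it commutes with the projection.\<close>
  have E_comm: "blinfun_apply E (blinfun_apply T x) = blinfun_apply T (blinfun_apply E x)"
    if T: "hermitian T" and TM: "\<And>x. x \<in> M \<Longrightarrow> blinfun_apply T x \<in> M" for T x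
  proof (rule cinner_right_cancel)
    fix z
    have *: "blinfun_apply E (blinfun_apply T (blinfun_apply E x)) = blinfun_apply T (blinfun_apply E x)" for x
      by (intro Eid TM EM)
    have "cinner (blinfun_apply E (blinfun_apply T x)) z = cinner x (blinfun_apply T (blinfun_apply E z))"
      by (simp add: is_adjointD[OF E] is_adjointD[OF T])
    also have "\<dots> = cinner x (blinfun_apply E (blinfun_apply T (blinfun_apply E z)))"
      by (simp only: *)
    also have "\<dots> = cinner (blinfun_apply E (blinfun_apply T (blinfun_apply E x))) z"
      by (simp add: is_adjointD[OF E] is_adjointD[OF T])
    finally show "cinner (blinfun_apply E (blinfun_apply T x)) z = cinner (blinfun_apply T (blinfun_apply E x)) z"
      by (simp only: *)
  qed
  have commD: "blinfun_apply T (blinfun_apply U x) = blinfun_apply U (blinfun_apply T x)"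
    if "T o\<^sub>L U = U o\<^sub>L T" for T U :: "'a \<Rightarrow>\<^sub>L 'a" and x
    using that by (metis blinfun_apply_blinfun_compose)
  have EA: "blinfun_apply E (blinfun_apply A x) = blinfun_apply A (blinfun_apply E x)"
    and ER: "blinfun_apply E (blinfun_apply R x) = blinfun_apply R (blinfun_apply E x)" for x
    by (intro E_comm A R; simp add: M_def flip: commD[OF comm])+
  define S where "S = 2 *\<^sub>R E - id_blinfun"
  have EE: "blinfun_apply E (blinfun_apply E x) = blinfun_apply E x" for x
    by (rule Eid[OF EM])
  have "hermitian S" unfolding S_def by (intro is_adjoint_intros E)
  moreover have "S o\<^sub>L S = id_blinfun"
    by (rule blinfun_eqI) (simp add: S_def blinfun.bilinear_simps EE scaleR_2)
  moreover have "S o\<^sub>L R = A"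
  proof (rule blinfun_eqI)
    fix x
    \<comment> \<open>On M the operators R and A agree. On the orthogonal complement they are opposite,
      because (R + A) x lies in M for every x, by (R - A) (R + A) = 0.\<close>
    have RR: "blinfun_apply R (blinfun_apply R z) = blinfun_apply A (blinfun_apply A z)" for z
      using square by (metis blinfun_apply_blinfun_compose)
    have "blinfun_apply (R + A) x \<in> M"
      by (simp add: M_def blinfun.bilinear_simps RR commD[OF comm] add.commute)
    from Eid[OF this] have "blinfun_apply R (blinfun_apply E x) + blinfun_apply A (blinfun_apply E x)
        = blinfun_apply R x + blinfun_apply A x"
      by (simp add: blinfun.bilinear_simps EA ER)
    moreover have "blinfun_apply R (blinfun_apply E x) = blinfun_apply A (blinfun_apply E x)"
      using EM by (simp add: M_def)
    ultimately have "2 *\<^sub>R blinfun_apply R (blinfun_apply E x) = blinfun_apply R x + blinfun_apply A x"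
      by (simp add: scaleR_2)
    then show "blinfun_apply (S o\<^sub>L R) x = blinfun_apply A x"
      by (simp add: S_def blinfun.bilinear_simps ER)
  qed
  moreover have "T o\<^sub>L S = S o\<^sub>L T"
    if "hermitian T" "T o\<^sub>L A = A o\<^sub>L T" "T o\<^sub>L R = R o\<^sub>L T" for T
  proof (rule blinfun_eqI)
    fix x
    have "blinfun_apply E (blinfun_apply T x) = blinfun_apply T (blinfun_apply E x)"
      by (rule E_comm[OF that(1)]) (simp add: M_def flip: commD[OF that(2)] commD[OF that(3)])
    then show "blinfun_apply (T o\<^sub>L S) x = blinfun_apply (S o\<^sub>L T) x"
      by (simp add: S_def blinfun.bilinear_simps)
  qed
  ultimately show ?thesis by (rule that)
qed

section \<open>Close projections are unitarily equivalent\<close>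

lemma hermitian_sign_is_unitary:
  assumes "hermitian S" "S o\<^sub>L S = id_blinfun"
  shows "S \<in> unitary_ops" "cadjoint S = S"
  using assms unitary_ops_iff cadjoint_eqI by blast+

text \<open>The operator H = P + Q - 1 satisfies H P = Q P = Q H, so it intertwines the projections, but
  it need not be unitary. Since H H = 1 - (P - Q) (P - Q), its sign S is obtained from the square root R of
  the right-hand side; R is injective because P - Q has norm less than 1, and therefore S inherits
  the intertwining relation.\<close>

lemma unitarily_equivalent_if_norm_diff_less:
  fixes P Q :: "'a::chilbert_space \<Rightarrow>\<^sub>L 'a"
  assumes P: "P \<in> projections" and Q: "Q \<in> projections" and less: "norm (P - Q) < 1"
  shows "unitarily_equivalent P Q"
proof -
  have hP: "hermitian P" and hQ: "hermitian Q" using P Q by (auto simp: projections_iff)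
  have PP: "blinfun_apply P (blinfun_apply P x) = blinfun_apply P x"
    and QQ: "blinfun_apply Q (blinfun_apply Q x) = blinfun_apply Q x" for x
    using P Q unfolding projections_iff by (metis blinfun_apply_blinfun_compose)+
  define H where "H = P + Q - id_blinfun"
  define X where "X = (P - Q) o\<^sub>L (P - Q)"
  define R where "R = sqrt_one_minus X"
  have hH: "hermitian H" unfolding H_def by (intro is_adjoint_intros hP hQ)
  have hX: "hermitian X" unfolding X_def by (intro is_adjoint_intros hP hQ)
  have "norm X \<le> norm (P - Q) * norm (P - Q)"
    unfolding X_def by (rule norm_blinfun_compose)
  also have "\<dots> < 1" using less mult_strict_mono[of "norm (P - Q)" 1 "norm (P - Q)" 1] by simp
  finally have X1: "norm X < 1" .
  then have Xle: "norm X \<le> 1" by simp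
  have XP: "P o\<^sub>L X = X o\<^sub>L P" and XQ: "Q o\<^sub>L X = X o\<^sub>L Q"
    by (rule blinfun_eqI, simp add: X_def blinfun.bilinear_simps PP QQ)+
  have XH: "H o\<^sub>L X = X o\<^sub>L H"
    by (rule blinfun_eqI) (simp add: X_def H_def blinfun.bilinear_simps PP QQ)
  have hR: "hermitian R" unfolding R_def by (rule hermitian_sqrt_one_minus[OF Xle hX])
  have RR: "R o\<^sub>L R = id_blinfun - X" unfolding R_def by (rule sqrt_one_minus_square[OF Xle])
  have HH: "id_blinfun - X = H o\<^sub>L H"
    by (rule blinfun_eqI) (simp add: X_def H_def blinfun.bilinear_simps PP QQ)
  have RH: "H o\<^sub>L R = R o\<^sub>L H" and RP: "P o\<^sub>L R = R o\<^sub>L P" and RQ: "Q o\<^sub>L R = R o\<^sub>L Q"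
    unfolding R_def by (intro sqrt_one_minus_commute Xle XH XP XQ)+
  obtain S where hS: "hermitian S" and SS: "S o\<^sub>L S = id_blinfun" and SR: "S o\<^sub>L R = H"
    and comm: "\<And>T. hermitian T \<Longrightarrow> T o\<^sub>L H = H o\<^sub>L T \<Longrightarrow> T o\<^sub>L R = R o\<^sub>L T \<Longrightarrow> T o\<^sub>L S = S o\<^sub>L T"
    using hermitian_sign[OF hH hR RH] RR HH by metis
  have RS: "R o\<^sub>L S = H" using comm[OF hR RH[symmetric]] SR by simp
  have R_inj: "x = y" if "blinfun_apply R x = blinfun_apply R y" for x y
  proof (rule ccontr)
    assume "x \<noteq> y"
    define z where "z = x - y"
    have "blinfun_apply R z = 0" using that by (simp add: z_def blinfun.diff_right)
    then have "z = blinfun_apply X z"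
      using arg_cong[OF RR, of "\<lambda>T. blinfun_apply T z"] by (simp add: blinfun.bilinear_simps)
    then have "norm z \<le> norm X * norm z" by (metis norm_blinfun)
    then show False using X1 \<open>x \<noteq> y\<close> by (simp add: z_def)
  qed
  \<comment> \<open>R (S P) = H P = Q H = R (Q S), and R is injective.\<close>
  have "S o\<^sub>L P = Q o\<^sub>L S"
  proof (rule blinfun_eqI, rule R_inj)
    fix x
    have "R o\<^sub>L S o\<^sub>L P = Q o\<^sub>L (R o\<^sub>L S)"
      unfolding RS by (rule blinfun_eqI) (simp add: H_def blinfun.bilinear_simps PP QQ)
    also have "\<dots> = R o\<^sub>L (Q o\<^sub>L S)" by (simp add: RQ flip: blinfun_compose_assoc)
    finally show "blinfun_apply R (blinfun_apply (S o\<^sub>L P) x) = blinfun_apply R (blinfun_apply (Q o\<^sub>L S) x)"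
      by (metis blinfun_apply_blinfun_compose)
  qed
  then have "Q = S o\<^sub>L P o\<^sub>L S" using SS by (simp add: blinfun_compose_assoc blinfun_compose_id)
  then show ?thesis
    unfolding unitarily_equivalent_def
    using hermitian_sign_is_unitary[OF hS SS] by (intro bexI[of _ S]) simp_all
qed

section \<open>The unitary group is path-connected\<close>

lemma unitary_ops_apply:
  assumes W: "W \<in> unitary_ops"
  shows "blinfun_apply (cadjoint W) (blinfun_apply W x) = x"
    "blinfun_apply W (blinfun_apply (cadjoint W) x) = x"
  using W unfolding unitary_ops_def
  by (metis (mono_tags, lifting) blinfun_apply_blinfun_compose id_blinfun.rep_eq id_apply mem_Collect_eq)+

lemma unitary_ops_adjoint: "W \<in> unitary_ops \<Longrightarrow> is_adjoint W (cadjoint W)"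
  by (simp add: unitary_ops_def is_adjoint_cadjoint)

lemma unitary_ops_norm:
  assumes W: "W \<in> unitary_ops"
  shows "norm (blinfun_apply W x) = norm x"
proof -
  have "cinner (blinfun_apply W x) (blinfun_apply W x) = cinner x x"
    by (simp add: is_adjointD[OF unitary_ops_adjoint[OF W]] unitary_ops_apply[OF W])
  then have "(norm (blinfun_apply W x))\<^sup>2 = (norm x)\<^sup>2"
    unfolding cinner_self by (simp only: of_real_eq_iff)
  then show ?thesis by (simp add: power2_eq_iff_nonneg)
qed

lemma unitary_ops_id: "id_blinfun \<in> unitary_ops"
  using unitary_ops_iff is_adjoint_id blinfun_compose_id by blast

lemma unitary_ops_cadjoint:
  assumes "W \<in> unitary_ops"
  shows "cadjoint W \<in> unitary_ops" "cadjoint (cadjoint W) = W"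
  using assms is_adjoint_sym[OF unitary_ops_adjoint[OF assms]]
  by (auto simp: cadjoint_eqI unitary_ops_def dest: is_adjoint_bounded_ops)

lemma unitary_ops_compose:
  assumes V: "V \<in> unitary_ops" and W: "W \<in> unitary_ops"
  shows "V o\<^sub>L W \<in> unitary_ops" "cadjoint (V o\<^sub>L W) = cadjoint W o\<^sub>L cadjoint V"
proof -
  have *: "is_adjoint (V o\<^sub>L W) (cadjoint W o\<^sub>L cadjoint V)"
    by (intro is_adjoint_compose unitary_ops_adjoint assms)
  then show "cadjoint (V o\<^sub>L W) = cadjoint W o\<^sub>L cadjoint V" by (rule cadjoint_eqI)
  have "cadjoint W o\<^sub>L cadjoint V o\<^sub>L (V o\<^sub>L W) = id_blinfun"
    "(V o\<^sub>L W) o\<^sub>L (cadjoint W o\<^sub>L cadjoint V) = id_blinfun"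
    by (rule blinfun_eqI, simp add: unitary_ops_apply assms)+
  with * show "V o\<^sub>L W \<in> unitary_ops" unfolding unitary_ops_iff by blast
qed

definition imag_unit_op :: "'a::chilbert_space \<Rightarrow>\<^sub>L 'a" where
  "imag_unit_op = Blinfun (\<lambda>x. \<i> *\<^sub>C x)"

lemma imag_unit_op_apply: "blinfun_apply imag_unit_op x = \<i> *\<^sub>C x"
  by (simp add: imag_unit_op_def bounded_linear_Blinfun_apply bounded_linear_scaleC)

lemma imag_unit_op_twice: "blinfun_apply imag_unit_op (blinfun_apply imag_unit_op x) = - x"
  using scaleR_scaleC[of "-1" x] by (simp add: imag_unit_op_apply scaleC_scaleC)

lemma imag_unit_op_commute:
  assumes "is_adjoint A B"
  shows "blinfun_apply A (blinfun_apply imag_unit_op x) = blinfun_apply imag_unit_op (blinfun_apply A x)"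
  using is_adjoint_bounded_ops[OF assms] by (simp add: imag_unit_op_apply bounded_ops_def)

lemma is_adjoint_imag_unit_op: "is_adjoint imag_unit_op (- imag_unit_op)"
  by (simp add: is_adjoint_def imag_unit_op_apply blinfun.minus_left cinner_simps)

text \<open>These are the operator versions of the points cos a + i sin a of the unit circle: a Hermitian
  real part and a commuting Hermitian imaginary part whose squares add up to 1.\<close>

lemma real_imag_unitary:
  assumes C: "hermitian C" and D: "hermitian D" and CD: "C o\<^sub>L D = D o\<^sub>L C"
    and sq: "(C o\<^sub>L C) + (D o\<^sub>L D) = id_blinfun"
  shows "C + (imag_unit_op o\<^sub>L D) \<in> unitary_ops"
proof -
  let ?V = "C - (imag_unit_op o\<^sub>L D)"
  have eq: "D o\<^sub>L (- imag_unit_op) = - (imag_unit_op o\<^sub>L D)"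
    by (rule blinfun_eqI) (simp add: blinfun.bilinear_simps imag_unit_op_commute[OF D])
  have "is_adjoint (C + (imag_unit_op o\<^sub>L D)) ?V"
    using is_adjoint_add[OF C is_adjoint_compose[OF is_adjoint_imag_unit_op D]] by (simp add: eq)
  moreover have CD': "blinfun_apply C (blinfun_apply D x) = blinfun_apply D (blinfun_apply C x)" for x
    using CD by (metis blinfun_apply_blinfun_compose)
  have sq': "blinfun_apply C (blinfun_apply C x) + blinfun_apply D (blinfun_apply D x) = x" for x
    using arg_cong[OF sq, of "\<lambda>T. blinfun_apply T x"] by (simp add: blinfun.bilinear_simps)
  have "?V o\<^sub>L (C + (imag_unit_op o\<^sub>L D)) = id_blinfun"
    "(C + (imag_unit_op o\<^sub>L D)) o\<^sub>L ?V = id_blinfun"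
    by (rule blinfun_eqI, simp add: blinfun.bilinear_simps imag_unit_op_commute[OF C]
        imag_unit_op_commute[OF D] imag_unit_op_twice CD' sq')+
  ultimately show ?thesis unfolding unitary_ops_iff by blast
qed

lemma path_component_real_imag:
  fixes C D :: "real \<Rightarrow> ('a::chilbert_space \<Rightarrow>\<^sub>L 'a)"
  assumes "continuous_on {0..1} C" "continuous_on {0..1} D"
    and "\<And>t. 0 \<le> t \<Longrightarrow> t \<le> 1 \<Longrightarrow> hermitian (C t)" "\<And>t. 0 \<le> t \<Longrightarrow> t \<le> 1 \<Longrightarrow> hermitian (D t)"
    and "\<And>t. 0 \<le> t \<Longrightarrow> t \<le> 1 \<Longrightarrow> C t o\<^sub>L D t = D t o\<^sub>L C t"
    and "\<And>t. 0 \<le> t \<Longrightarrow> t \<le> 1 \<Longrightarrow> (C t o\<^sub>L C t) + (D t o\<^sub>L D t) = id_blinfun"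
  shows "path_component unitary_ops (C 0 + (imag_unit_op o\<^sub>L D 0)) (C 1 + (imag_unit_op o\<^sub>L D 1))"
  unfolding path_component_def
proof (intro exI[of _ "\<lambda>t. C t + (imag_unit_op o\<^sub>L D t)"] conjI)
  show "path (\<lambda>t. C t + (imag_unit_op o\<^sub>L D t))"
    unfolding path_def
    by (intro continuous_intros assms bounded_bilinear.continuous_on[OF bounded_bilinear_blinfun_compose])
  show "path_image (\<lambda>t. C t + (imag_unit_op o\<^sub>L D t)) \<subseteq> unitary_ops"
    unfolding path_image_def using assms by (auto intro!: real_imag_unitary)
qed (simp_all add: pathstart_def pathfinish_def)

text \<open>The paths cos a S + i sin a S and cos a 1 + i sin a S for a from 0 to pi/2 join S and
  1 to the same endpoint i S.\<close>

lemma path_component_hermitian_unitary: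
  assumes S: "hermitian S" and SS: "S o\<^sub>L S = id_blinfun"
  shows "path_component unitary_ops S id_blinfun"
proof -
  have SS': "blinfun_apply S (blinfun_apply S x) = x" for x
    using SS by (metis blinfun_apply_blinfun_compose id_blinfun.rep_eq id_apply)
  have trig: "((cos a)\<^sup>2 *\<^sub>R x) + ((sin a)\<^sup>2 *\<^sub>R x) = x" for a and x :: 'a
    by (simp flip: scaleR_left_distrib)
  have "path_component unitary_ops
      (cos (pi / 2 * 0) *\<^sub>R S + (imag_unit_op o\<^sub>L sin (pi / 2 * 0) *\<^sub>R S))
      (cos (pi / 2 * 1) *\<^sub>R S + (imag_unit_op o\<^sub>L sin (pi / 2 * 1) *\<^sub>R S))"
    by (rule path_component_real_imag; (intro continuous_intros is_adjoint_intros S)?;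
        rule blinfun_eqI; simp add: blinfun.bilinear_simps SS' trig flip: power2_eq_square)
  moreover have "path_component unitary_ops
      (cos (pi / 2 * 0) *\<^sub>R id_blinfun + (imag_unit_op o\<^sub>L sin (pi / 2 * 0) *\<^sub>R S))
      (cos (pi / 2 * 1) *\<^sub>R id_blinfun + (imag_unit_op o\<^sub>L sin (pi / 2 * 1) *\<^sub>R S))"
    by (rule path_component_real_imag; (intro continuous_intros is_adjoint_intros S)?;
        rule blinfun_eqI; simp add: blinfun.bilinear_simps SS' trig flip: power2_eq_square)
  moreover have "(imag_unit_op :: 'a \<Rightarrow>\<^sub>L 'a) o\<^sub>L 0 = 0"
    by (rule blinfun_eqI) (simp add: blinfun.bilinear_simps)
  ultimately show ?thesis
    by simp (blast intro: path_component_trans path_component_sym)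
qed

text \<open>Write U = A + i B with commuting Hermitian A and B. Shrinking the imaginary part to t B forces
  the real part to be a square root of 1 - t^2 B B, and it has to equal A at t = 1. The sign S of A,
  which commutes with B, makes S sqrt (1 - t^2 B B) such a choice. At t = 0 the path reaches the
  symmetry S.\<close>

lemma path_component_unitary_id:
  fixes U :: "'a::chilbert_space \<Rightarrow>\<^sub>L 'a"
  assumes U: "U \<in> unitary_ops"
  shows "path_component unitary_ops U id_blinfun"
proof -
  define V where "V = cadjoint U"
  note UV = unitary_ops_adjoint[OF U, folded V_def]
  note VU = is_adjoint_sym[OF UV]
  note app = unitary_ops_apply[OF U, folded V_def]
  note J = imag_unit_op_commute[OF UV] imag_unit_op_commute[OF VU] imag_unit_op_twice
  define A where "A = (1/2) *\<^sub>R (U + V)"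
  define B where "B = (- 1/2) *\<^sub>R (imag_unit_op o\<^sub>L (U - V))"
  have half: "(1/2) *\<^sub>R x + (1/2) *\<^sub>R x = x" for x :: 'a by (simp flip: scaleR_left_distrib)
  have U_eq: "U = A + (imag_unit_op o\<^sub>L B)"
    by (rule blinfun_eqI) (simp add: A_def B_def blinfun.bilinear_simps J algebra_simps half)
  have hA: "hermitian A"
    using is_adjoint_scaleR[OF is_adjoint_add[OF UV VU], of "1/2"] by (simp add: A_def add.commute)
  have hB: "hermitian B"
    unfolding is_adjoint_def
    by (simp add: B_def blinfun.bilinear_simps imag_unit_op_apply cinner_simps
        is_adjointD[OF UV] is_adjointD[OF VU] algebra_simps)
  have AB: "A o\<^sub>L B = B o\<^sub>L A"
    by (rule blinfun_eqI) (simp add: A_def B_def blinfun.bilinear_simps J app algebra_simps)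
  have AABB: "(A o\<^sub>L A) + (B o\<^sub>L B) = id_blinfun"
    by (rule blinfun_eqI)
      (simp add: A_def B_def blinfun.bilinear_simps J app algebra_simps half flip: scaleR_left_distrib)
  have A': "blinfun_apply A (blinfun_apply B x) = blinfun_apply B (blinfun_apply A x)" for x
    using AB by (metis blinfun_apply_blinfun_compose)
  have B1: "norm B \<le> 1"
  proof (rule norm_blinfun_bound)
    fix x
    have "norm (blinfun_apply B x) = norm (blinfun_apply U x - blinfun_apply V x) / 2"
      by (simp add: B_def blinfun.scaleR_left blinfun.minus_left blinfun.diff_left
          imag_unit_op_apply norm_scaleC)
    also have "\<dots> \<le> (norm (blinfun_apply U x) + norm (blinfun_apply V x)) / 2"
      by (intro divide_right_mono norm_triangle_ineq4) simp
    also have "\<dots> = 1 * norm x"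
      by (simp add: unitary_ops_norm U V_def unitary_ops_cadjoint(1))
    finally show "norm (blinfun_apply B x) \<le> 1 * norm x" .
  qed simp
  define X where "X t = t\<^sup>2 *\<^sub>R (B o\<^sub>L B)" for t :: real
  have X1: "norm (X t) \<le> 1" if "0 \<le> t" "t \<le> 1" for t
  proof -
    have "norm (B o\<^sub>L B) \<le> norm B * norm B" by (rule norm_blinfun_compose)
    also have "\<dots> \<le> 1" using B1 by (simp add: mult_le_one)
    finally have "t\<^sup>2 * norm (B o\<^sub>L B) \<le> 1" using that by (intro mult_le_one) (auto simp: power_le_one)
    then show ?thesis by (simp add: X_def)
  qed
  have hX: "hermitian (X t)" for t unfolding X_def by (intro is_adjoint_intros hB)
  define R where "R t = sqrt_one_minus (X t)" for t
  have hR: "hermitian (R t)" if "0 \<le> t" "t \<le> 1" for t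
    unfolding R_def by (intro hermitian_sqrt_one_minus X1 hX that)
  have RR: "R t o\<^sub>L R t = id_blinfun - X t" if "0 \<le> t" "t \<le> 1" for t
    unfolding R_def by (intro sqrt_one_minus_square X1 that)
  have R_comm: "T o\<^sub>L R t = R t o\<^sub>L T" if "0 \<le> t" "t \<le> 1" "T o\<^sub>L B = B o\<^sub>L T" for t T
  proof -
    have "blinfun_apply T (blinfun_apply B x) = blinfun_apply B (blinfun_apply T x)" for x
      using that(3) by (metis blinfun_apply_blinfun_compose)
    then have "T o\<^sub>L X t = X t o\<^sub>L T"
      by (intro blinfun_eqI) (simp add: X_def blinfun.bilinear_simps)
    then show ?thesis unfolding R_def by (intro sqrt_one_minus_commute X1 that)
  qed
  have "R 1 o\<^sub>L R 1 = A o\<^sub>L A"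
    using RR[of 1] by (simp add: X_def flip: AABB)
  then obtain S where hS: "hermitian S" and SS: "S o\<^sub>L S = id_blinfun" and SR: "S o\<^sub>L R 1 = A"
    and comm: "\<And>T. hermitian T \<Longrightarrow> T o\<^sub>L A = A o\<^sub>L T \<Longrightarrow> T o\<^sub>L R 1 = R 1 o\<^sub>L T \<Longrightarrow> T o\<^sub>L S = S o\<^sub>L T"
    using hermitian_sign[OF hA hR[of 1] R_comm[of 1 A]] AB by auto
  have SB: "S o\<^sub>L B = B o\<^sub>L S"
    using comm[OF hB AB[symmetric] R_comm[of 1 B]] by simp
  have SR': "S o\<^sub>L R t = R t o\<^sub>L S" and BR: "B o\<^sub>L R t = R t o\<^sub>L B" if "0 \<le> t" "t \<le> 1" for t
    using that SB by (auto intro: R_comm)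
  define C where "C t = S o\<^sub>L R t" for t
  define D where "D t = t *\<^sub>R B" for t :: real
  have "path_component unitary_ops (C 0 + (imag_unit_op o\<^sub>L D 0)) (C 1 + (imag_unit_op o\<^sub>L D 1))"
  proof (rule path_component_real_imag)
    have "continuous_on {0..1} R"
      unfolding R_def
      by (rule continuous_on_compose2[OF continuous_on_sqrt_one_minus])
        (auto simp: X1, auto simp: X_def intro!: continuous_intros)
    then show "continuous_on {0..1} C"
      unfolding C_def
      by (intro bounded_bilinear.continuous_on[OF bounded_bilinear_blinfun_compose] continuous_intros)
    show "continuous_on {0..1} D" unfolding D_def by (intro continuous_intros)
    fix t :: real assume t: "0 \<le> t" "t \<le> 1"
    show "hermitian (C t)"
      using is_adjoint_compose[OF hS hR[OF t]] by (simp add: C_def SR'[OF t])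
    show "hermitian (D t)" unfolding D_def by (intro is_adjoint_scaleR hB)
    have S': "blinfun_apply S (blinfun_apply B x) = blinfun_apply B (blinfun_apply S x)"
      "blinfun_apply (R t) (blinfun_apply S x) = blinfun_apply S (blinfun_apply (R t) x)"
      "blinfun_apply (R t) (blinfun_apply B x) = blinfun_apply B (blinfun_apply (R t) x)"
      "blinfun_apply S (blinfun_apply S x) = x"
      "blinfun_apply (R t) (blinfun_apply (R t) x) = x - blinfun_apply (X t) x" for x
      using SB SR'[OF t] BR[OF t] SS RR[OF t]
      by (metis blinfun_apply_blinfun_compose id_blinfun.rep_eq id_apply blinfun.diff_left)+
    show "C t o\<^sub>L D t = D t o\<^sub>L C t"
      by (rule blinfun_eqI) (simp add: C_def D_def blinfun.bilinear_simps S')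
    show "(C t o\<^sub>L C t) + (D t o\<^sub>L D t) = id_blinfun"
      by (rule blinfun_eqI)
        (simp add: C_def D_def X_def blinfun.bilinear_simps S' power2_eq_square)
  qed
  moreover have "C 1 + (imag_unit_op o\<^sub>L D 1) = U"
    by (simp add: C_def D_def SR flip: U_eq)
  moreover have "C 0 + (imag_unit_op o\<^sub>L D 0) = S"
    by (rule blinfun_eqI) (simp add: C_def D_def R_def X_def sqrt_one_minus_zero blinfun.bilinear_simps)
  ultimately have "path_component unitary_ops S U" by simp
  with path_component_hermitian_unitary[OF hS SS] show ?thesis
    by (blast intro: path_component_trans path_component_sym)
qed

lemma path_connected_unitary_ops: "path_connected (unitary_ops :: ('a::chilbert_space \<Rightarrow>\<^sub>L 'a) set)"
  unfolding path_connected_component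
  using path_component_unitary_id by (blast intro: path_component_trans path_component_sym)

section \<open>The orbits are connected\<close>

lemma orbit_iff:
  "(P, f) \<in> proj_vectors_orbit P0 \<longleftrightarrow> (P, f) \<in> proj_vectors \<and> unitarily_equivalent P0 P"
  by (simp add: proj_vectors_orbit_def unitarily_equivalent_def)

lemma unitarily_equivalent_refl: "unitarily_equivalent P P"
  unfolding unitarily_equivalent_def
  by (intro bexI[OF _ unitary_ops_id]) (simp add: cadjoint_eqI[OF is_adjoint_id] blinfun_compose_id)

lemma unitarily_equivalent_sym:
  assumes "unitarily_equivalent P Q"
  shows "unitarily_equivalent Q P"
proof -
  obtain W where W: "W \<in> unitary_ops" "Q = W o\<^sub>L P o\<^sub>L cadjoint W"
    using assms by (auto simp: unitarily_equivalent_def)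
  have "P = cadjoint W o\<^sub>L Q o\<^sub>L cadjoint (cadjoint W)"
    by (rule blinfun_eqI) (simp add: W unitary_ops_apply unitary_ops_cadjoint)
  then show ?thesis
    using unitary_ops_cadjoint(1)[OF W(1)] by (auto simp: unitarily_equivalent_def)
qed

lemma unitarily_equivalent_trans:
  assumes "unitarily_equivalent P Q" "unitarily_equivalent Q R"
  shows "unitarily_equivalent P R"
proof -
  obtain V W where V: "V \<in> unitary_ops" "Q = V o\<^sub>L P o\<^sub>L cadjoint V"
    and W: "W \<in> unitary_ops" "R = W o\<^sub>L Q o\<^sub>L cadjoint W"
    using assms by (auto simp: unitarily_equivalent_def)
  have "R = (W o\<^sub>L V) o\<^sub>L P o\<^sub>L cadjoint (W o\<^sub>L V)"
    by (rule blinfun_eqI) (simp add: W(2) V(2) unitary_ops_compose(2)[OF W(1) V(1)])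
  then show ?thesis
    using unitary_ops_compose(1)[OF W(1) V(1)] unfolding unitarily_equivalent_def by blast
qed

lemma unit_vector_in_range:
  assumes P: "P \<in> projections" and "P \<noteq> 0"
  obtains f where "(P, f) \<in> proj_vectors"
proof -
  obtain x where x: "blinfun_apply P x \<noteq> 0"
    using \<open>P \<noteq> 0\<close> by (metis blinfun_eqI zero_blinfun.rep_eq)
  define f where "f = (1 / norm (blinfun_apply P x)) *\<^sub>R blinfun_apply P x"
  have "blinfun_apply P (blinfun_apply P x) = blinfun_apply P x"
    using P unfolding projections_iff by (metis blinfun_apply_blinfun_compose)
  then have "(P, f) \<in> proj_vectors"
    using P x by (simp add: proj_vectors_def f_def blinfun.scaleR_right)
  then show ?thesis by (rule that)
qed

lemma conjugate_in_orbit: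
  assumes "(P, f) \<in> proj_vectors" and W: "W \<in> unitary_ops"
  shows "(W o\<^sub>L P o\<^sub>L cadjoint W, blinfun_apply W f) \<in> proj_vectors_orbit P"
proof -
  have P: "hermitian P" "P o\<^sub>L P = P" and f: "blinfun_apply P f = f" "norm f = 1"
    using assms(1) by (auto simp: proj_vectors_def projections_iff)
  have PP: "blinfun_apply P (blinfun_apply P x) = blinfun_apply P x" for x
    using P(2) by (metis blinfun_apply_blinfun_compose)
  have "hermitian (W o\<^sub>L P o\<^sub>L cadjoint W)"
    using is_adjoint_compose[OF is_adjoint_compose[OF unitary_ops_adjoint[OF W] P(1)]
        is_adjoint_sym[OF unitary_ops_adjoint[OF W]]]
    by (simp add: blinfun_compose_assoc)
  moreover have "(W o\<^sub>L P o\<^sub>L cadjoint W) o\<^sub>L (W o\<^sub>L P o\<^sub>L cadjoint W) = W o\<^sub>L P o\<^sub>L cadjoint W"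
    by (rule blinfun_eqI) (simp add: unitary_ops_apply[OF W] PP)
  ultimately show ?thesis
    using W by (auto simp: orbit_iff proj_vectors_def projections_iff unitary_ops_apply[OF W]
        unitary_ops_norm[OF W] f unitarily_equivalent_def)
qed

text \<open>Taking adjoints is additive and does not increase the norm, hence it is Lipschitz with
  constant 1.\<close>

lemma continuous_on_cadjoint: "continuous_on unitary_ops cadjoint"
  unfolding continuous_on_iff
proof (intro ballI allI impI exI conjI)
  fix V and e :: real and W :: "'a \<Rightarrow>\<^sub>L 'a"
  assume "V \<in> unitary_ops" "W \<in> unitary_ops" and d: "dist W V < e"
  then have "norm (cadjoint W - cadjoint V) \<le> norm (W - V)"
    by (intro is_adjoint_norm_le is_adjoint_diff unitary_ops_adjoint)
  with d show "dist (cadjoint W) (cadjoint V) < e" by (simp add: dist_norm)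
qed

text \<open>The segment between the two vectors, normalized, is a path of unit vectors unless it passes
  through 0, that is, unless the vectors are antipodal. Antipodal vectors are joined by rotating the
  phase.\<close>

lemma path_component_unit_vectors:
  fixes P :: "'a::chilbert_space \<Rightarrow>\<^sub>L 'a"
  assumes f: "(P, f) \<in> proj_vectors" and g: "(P, g) \<in> proj_vectors"
  shows "path_component (proj_vectors_orbit P) (P, f) (P, g)"
proof -
  have P: "P \<in> projections" and Pf: "blinfun_apply P f = f" "norm f = 1"
    and Pg: "blinfun_apply P g = g" "norm g = 1"
    using f g by (auto simp: proj_vectors_def)
  show ?thesis
  proof (cases "f + g = 0")
    case True
    have lin: "blinfun_apply P (c *\<^sub>C x) = c *\<^sub>C blinfun_apply P x" for c x
      using P by (auto simp: projections_def bounded_ops_def)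
    have gf: "g = (-1) *\<^sub>C f"
      using minus_unique[OF True] scaleR_scaleC[of "-1" f] by simp
    have "bounded_linear (\<lambda>c. c *\<^sub>C f)"
      by (rule bounded_linear_intro[where K = "norm f"])
        (simp_all add: scaleC_add_left scaleR_scaleC scaleC_scaleC scaleC_complex_def norm_scaleC)
    then have "path (\<lambda>t. (P, cis (pi * t) *\<^sub>C f))"
      unfolding path_def
      by (intro continuous_on_Pair continuous_on_const bounded_linear.continuous_on[of "\<lambda>c. c *\<^sub>C f"]
          continuous_intros)
    moreover have "path_image (\<lambda>t. (P, cis (pi * t) *\<^sub>C f)) \<subseteq> proj_vectors_orbit P"
      using P Pf by (auto simp: path_image_def orbit_iff unitarily_equivalent_refl proj_vectors_def
          lin norm_scaleC)
    ultimately show ?thesis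
      unfolding path_component_def
      by (intro exI[of _ "\<lambda>t. (P, cis (pi * t) *\<^sub>C f)"])
        (simp add: pathstart_def pathfinish_def scaleC_one gf)
  next
    case False
    define h where "h t = (1 - t) *\<^sub>R f + t *\<^sub>R g" for t :: real
    have h0: "h t \<noteq> 0" if "0 \<le> t" "t \<le> 1" for t
    proof
      assume "h t = 0"
      then have eq: "(1 - t) *\<^sub>R f = - (t *\<^sub>R g)" by (simp add: h_def eq_neg_iff_add_eq_0)
      then have "norm ((1 - t) *\<^sub>R f) = norm (t *\<^sub>R g)" by simp
      then have t: "t = 1/2" using that Pf Pg by simp
      have "(1/2) *\<^sub>R (f + g) = 0" using \<open>h t = 0\<close> by (simp add: h_def t scaleR_right_distrib)
      with False show False by simp
    qed
    let ?p = "\<lambda>t. (P, (1 / norm (h t)) *\<^sub>R h t)"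
    have "path ?p"
      unfolding path_def using h0
      by (intro continuous_on_Pair continuous_on_const) (auto intro!: continuous_intros simp: h_def)
    moreover have "blinfun_apply P (h t) = h t" for t
      by (simp add: h_def blinfun.bilinear_simps Pf Pg)
    then have "path_image ?p \<subseteq> proj_vectors_orbit P"
      using P h0 by (auto simp: path_image_def orbit_iff unitarily_equivalent_refl proj_vectors_def
          blinfun.scaleR_right)
    ultimately show ?thesis
      unfolding path_component_def
      by (intro exI[of _ ?p]) (simp add: pathstart_def pathfinish_def h_def Pf Pg)
  qed
qed

text \<open>Let P = W P0 W*. A path of unitaries from 1 to W, acting on the projection and on a vector,
  leads from P0 to P, but it carries W* f and not f0 to f. The two vectors W* f and f0 both lie in
  the range of P0, where they are joined with the projection kept fixed.\<close>

lemma path_connected_orbit: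
  fixes P0 :: "'a::chilbert_space \<Rightarrow>\<^sub>L 'a"
  assumes P0: "P0 \<in> projections"
  shows "path_connected (proj_vectors_orbit P0)"
proof (cases "P0 = 0")
  case True
  then show ?thesis by (simp add: proj_vectors_orbit_zero)
next
  case False
  then obtain f0 where f0: "(P0, f0) \<in> proj_vectors"
    using unit_vector_in_range[OF P0] by blast
  have "path_component (proj_vectors_orbit P0) (P0, f0) (P, f)"
    if Pf: "(P, f) \<in> proj_vectors_orbit P0" for P f
  proof -
    obtain W where W: "W \<in> unitary_ops" and P: "P = W o\<^sub>L P0 o\<^sub>L cadjoint W"
      using Pf[unfolded orbit_iff unitarily_equivalent_def] by blast
    have f: "blinfun_apply P f = f" "norm f = 1"
      using that by (auto simp: proj_vectors_orbit_def proj_vectors_def)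
    define g where "g = blinfun_apply (cadjoint W) f"
    have "blinfun_apply P0 g = blinfun_apply (cadjoint W) (blinfun_apply P f)"
      by (simp add: P g_def unitary_ops_apply[OF W])
    then have g: "(P0, g) \<in> proj_vectors"
      using P0 f by (simp add: proj_vectors_def g_def unitary_ops_norm unitary_ops_cadjoint W)
    define \<Phi> where "\<Phi> U = (U o\<^sub>L P0 o\<^sub>L cadjoint U, blinfun_apply U g)" for U
    have "continuous_on unitary_ops \<Phi>"
      unfolding \<Phi>_def
      by (intro continuous_on_Pair continuous_intros continuous_on_cadjoint
          bounded_bilinear.continuous_on[OF bounded_bilinear_blinfun_compose])
    then have "path_connected (\<Phi> ` unitary_ops)"
      by (rule path_connected_continuous_image[OF _ path_connected_unitary_ops])
    then have "path_component (\<Phi> ` unitary_ops) (\<Phi> id_blinfun) (\<Phi> W)"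
      unfolding path_connected_component using unitary_ops_id W by blast
    moreover have "\<Phi> ` unitary_ops \<subseteq> proj_vectors_orbit P0"
      using conjugate_in_orbit[OF g] by (auto simp: \<Phi>_def)
    moreover have "\<Phi> id_blinfun = (P0, g)"
      by (simp add: \<Phi>_def cadjoint_eqI[OF is_adjoint_id] blinfun_compose_id)
    moreover have "\<Phi> W = (P, f)"
      by (simp add: \<Phi>_def P g_def unitary_ops_apply[OF W])
    ultimately have "path_component (proj_vectors_orbit P0) (P0, g) (P, f)"
      using path_component_of_subset by metis
    with path_component_unit_vectors[OF f0 g] show ?thesis by (rule path_component_trans)
  qed
  then show ?thesis
    unfolding path_connected_component
    by (metis path_component_sym path_component_trans surj_pair)
qed

section \<open>The orbits are the components\<close>

lemma openin_orbit:
  assumes "P0 \<in> projections"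
  shows "openin (top_of_set proj_vectors) (proj_vectors_orbit P0)"
  unfolding openin_euclidean_subtopology_iff
proof (intro conjI ballI)
  show "proj_vectors_orbit P0 \<subseteq> proj_vectors" by (auto simp: proj_vectors_orbit_def)
  fix x assume "x \<in> proj_vectors_orbit P0"
  then obtain P f where x: "x = (P, f)" and P: "P \<in> projections" "unitarily_equivalent P0 P"
    by (cases x) (auto simp: orbit_iff proj_vectors_def)
  have "y \<in> proj_vectors_orbit P0" if y: "y \<in> proj_vectors" and d: "dist y x < 1" for y
  proof -
    obtain Q g where Qg: "y = (Q, g)" by fastforce
    have "norm (P - Q) \<le> dist y x"
      using dist_fst_le[of y x] by (simp add: x Qg dist_norm norm_minus_commute)
    then have "unitarily_equivalent P Q"
      using y d P(1) by (intro unitarily_equivalent_if_norm_diff_less) (auto simp: Qg proj_vectors_def)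
    then show ?thesis
      using y P(2) unitarily_equivalent_trans by (auto simp: Qg orbit_iff)
  qed
  then show "\<exists>e>0. \<forall>y\<in>proj_vectors. dist y x < e \<longrightarrow> y \<in> proj_vectors_orbit P0"
    by (intro exI[of _ 1]) simp
qed

text \<open>The orbits partition the space, so the complement of an orbit is a union of orbits, all of
  which are open.\<close>

lemma closedin_orbit:
  assumes "P0 \<in> projections"
  shows "closedin (top_of_set proj_vectors) (proj_vectors_orbit P0)"
proof -
  have "proj_vectors - proj_vectors_orbit P0 =
      \<Union> {proj_vectors_orbit P |P. P \<in> projections \<and> \<not> unitarily_equivalent P0 P}" (is "?L = \<Union> ?R")
  proof
    show "?L \<subseteq> \<Union> ?R"
    proof
      fix x assume x: "x \<in> ?L"
      obtain P f where Pf: "x = (P, f)" by fastforce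
      with x have "x \<in> proj_vectors_orbit P" "P \<in> projections" "\<not> unitarily_equivalent P0 P"
        by (auto simp: orbit_iff unitarily_equivalent_refl proj_vectors_def)
      then show "x \<in> \<Union> ?R" by blast
    qed
    show "\<Union> ?R \<subseteq> ?L"
      using unitarily_equivalent_sym unitarily_equivalent_trans by (fastforce simp: orbit_iff)
  qed
  moreover have "openin (top_of_set proj_vectors) (\<Union> ?R)"
    by (intro openin_Union) (auto intro: openin_orbit)
  ultimately show ?thesis
    by (auto simp: closedin_def proj_vectors_orbit_def)
qed

lemma orbit_in_components:
  assumes P0: "P0 \<in> projections" "P0 \<noteq> 0"
  shows "proj_vectors_orbit P0 \<in> components proj_vectors"
  unfolding in_components_maximal
proof (intro conjI allI impI)
  obtain f where "(P0, f) \<in> proj_vectors" using unit_vector_in_range[OF P0] by blast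
  then show ne: "proj_vectors_orbit P0 \<noteq> {}"
    using orbit_iff unitarily_equivalent_refl by blast
  show "proj_vectors_orbit P0 \<subseteq> proj_vectors" by (auto simp: proj_vectors_orbit_def)
  show "connected (proj_vectors_orbit P0)"
    by (intro path_connected_imp_connected path_connected_orbit P0)
  fix D assume D: "D \<noteq> {} \<and> proj_vectors_orbit P0 \<subseteq> D \<and> D \<subseteq> proj_vectors \<and> connected D"
  then have "openin (top_of_set D) (proj_vectors_orbit P0)"
    "closedin (top_of_set D) (proj_vectors_orbit P0)"
    using openin_orbit[OF P0(1)] closedin_orbit[OF P0(1)]
    by (blast intro: openin_subset_trans closedin_subset_trans)+
  with D ne show "D = proj_vectors_orbit P0"
    by (metis connected_clopen)
qed

lemma orbit_eq_iff:
  assumes "P0 \<in> projections" "P1 \<in> projections"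
  shows "proj_vectors_orbit P0 = proj_vectors_orbit P1 \<longleftrightarrow> unitarily_equivalent P0 P1"
proof
  assume "unitarily_equivalent P0 P1"
  then show "proj_vectors_orbit P0 = proj_vectors_orbit P1"
    using unitarily_equivalent_sym unitarily_equivalent_trans by (auto simp: orbit_iff) blast+
next
  assume eq: "proj_vectors_orbit P0 = proj_vectors_orbit P1"
  have nonzero: "\<exists>f. (P, f) \<in> proj_vectors_orbit P" if "P \<in> projections" "P \<noteq> 0" for P :: "'a \<Rightarrow>\<^sub>L 'a"
    using unit_vector_in_range[OF that] orbit_iff unitarily_equivalent_refl by metis
  show "unitarily_equivalent P0 P1"
  proof (cases "P1 = 0")
    case True
    then have "P0 = 0" using nonzero[OF assms(1)] eq by (auto simp: proj_vectors_orbit_zero)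
    with True show ?thesis by (simp add: unitarily_equivalent_refl)
  next
    case False
    then obtain f where "(P1, f) \<in> proj_vectors_orbit P0" using nonzero[OF assms(2)] eq by auto
    then show ?thesis by (simp add: orbit_iff)
  qed
qed

theorem corollary2p2:
  shows "components (proj_vectors :: (('a::chilbert_space \<Rightarrow>\<^sub>L 'a) \<times> 'a) set) =
           {proj_vectors_orbit P0 | P0. P0 \<in> projections \<and> P0 \<noteq> 0} \<and>
         (\<forall>P0 \<in> (projections :: ('a \<Rightarrow>\<^sub>L 'a) set). \<forall>P1 \<in> projections.
           proj_vectors_orbit P0 = proj_vectors_orbit P1 \<longleftrightarrow> unitarily_equivalent P0 P1)"
proof (intro conjI ballI orbit_eq_iff subset_antisym subsetI)
  fix C :: "(('a \<Rightarrow>\<^sub>L 'a) \<times> 'a) set"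
  assume C: "C \<in> components proj_vectors"
  then obtain x where xC: "x \<in> C" and "x \<in> proj_vectors"
    by (metis in_components_nonempty in_components_subset ex_in_conv subsetD)
  moreover obtain P f where x: "x = (P, f)" by fastforce
  ultimately have P: "P \<in> projections" "P \<noteq> 0" and orb: "x \<in> proj_vectors_orbit P"
    by (auto simp: orbit_iff proj_vectors_def unitarily_equivalent_refl blinfun.zero_left)
  have "C = proj_vectors_orbit P"
    using components_nonoverlap[OF C orbit_in_components[OF P]] xC orb by blast
  with P show "C \<in> {proj_vectors_orbit P0 | P0. P0 \<in> projections \<and> P0 \<noteq> 0}" by blast
next
  fix C :: "(('a \<Rightarrow>\<^sub>L 'a) \<times> 'a) set"
  assume "C \<in> {proj_vectors_orbit P0 | P0. P0 \<in> projections \<and> P0 \<noteq> 0}"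
  then show "C \<in> components proj_vectors" using orbit_in_components by blast
qed

end
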